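(* Let $(X_k)_{k\in\mathbb N}$ be a sequence of independent centered real random variables such that there is $c_0>0$ with $|X_k|\le c_0$ for all $k$, and there is $c_1>0$ with $\mathrm{Var}[X_k]=\mathbb E[X_k^2]\ge c_1$ for all $k$. Put $M_n=\frac1n\sum_{k=1}^n X_k$. Then there exists a positive function $J:(0,\infty)\to(0,\infty)$ such that $$\limsup_{n\to\infty}\frac1n\log\mathbb P[M_n\ge x]\le -J(x),\qquad x>0.$$
   Context: A random variable is centered if its expectation is $0$. Convention: $\log 0=-\infty$. *)

theory Defs
  imports "HOL-Probability.Probability"
begin

text \<open>Logarithm of a probability with the convention \<open>log 0 = -\<infinity>\<close>; the library's
  \<open>ln\<close> returns the real number \<open>0\<close> at \<open>0\<close>.  It is meant for arguments \<open>\<ge> 0\<close>.\<close>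

definition elog :: "real \<Rightarrow> ereal" where
  "elog p = (if p = 0 then -\<infinity> else ereal (ln p))"

definition emp_mean :: "(nat \<Rightarrow> 'a \<Rightarrow> real) \<Rightarrow> nat \<Rightarrow> 'a \<Rightarrow> real" where
  "emp_mean X n \<omega> = (1 / real n) * (\<Sum>k = 1..n. X k \<omega>)"

end

theory Submission
  imports Defs
begin

text \<open>Hoeffding's inequality gives exponential decay at every finite n: if the independent
  centered variables lie in [-c, c], then P[M_n >= x] <= exp(-n x^2 / (2 c^2)). Taking logarithms
  and dividing by n bounds every term with n >= 1 by the same number, so the limsup obeys the bound
  with J(x) = x^2 / (2 c^2). The probabilistic content is \<open>prob_emp_mean_ge_le\<close>;
  \<open>elog_le_iff\<close> carries it over to the extended logarithm.\<close>

text \<open>At \<open>p = 0\<close> both sides are true, so events of probability zero need no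
  separate treatment later.\<close>

lemma elog_le_iff:
  assumes "p \<ge> 0"
  shows "elog p \<le> ereal y \<longleftrightarrow> p \<le> exp y"
proof (cases "p = 0")
  case False
  with assms have "ln p \<le> y \<longleftrightarrow> p \<le> exp y"
    by (metis exp_le_cancel_iff exp_ln order_le_neq_trans)
  with False show ?thesis
    by (simp add: elog_def)
qed (simp add: elog_def)

text \<open>This is Hoeffding's inequality for the sum n M_n with deviation n x, each summand
  ranging over an interval of length 2c.\<close>

lemma (in prob_space) prob_emp_mean_ge_le:
  assumes indep: "indep_vars (\<lambda>_. borel) X {1..}"
    and centered: "\<And>k. k \<ge> 1 \<Longrightarrow> expectation (X k) = 0"
    and bounded: "\<And>k. k \<ge> 1 \<Longrightarrow> AE \<omega> in M. \<bar>X k \<omega>\<bar> \<le> c"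
    and "c > 0" "x \<ge> 0" "n \<ge> 1"
  shows "prob {\<omega> \<in> space M. emp_mean X n \<omega> \<ge> x} \<le> exp (- (real n * (x\<^sup>2 / (2 * c\<^sup>2))))"
proof -
  \<comment> \<open>The last parameter must be the expectation of the sum; it is evaluated to 0 only
    in \<open>mean_zero\<close>.\<close>
  interpret Hoeffding_ineq M "{1..n}" X "\<lambda>_. - c" "\<lambda>_. c" "\<Sum>k = 1..n. expectation (X k)"
  proof unfold_locales
    show "indep_vars (\<lambda>_. borel) X {1..n}"
      by (rule indep_vars_subset[OF indep]) auto
    show "AE \<omega> in M. X k \<omega> \<in> {- c..c}" if "k \<in> {1..n}" for k
      using bounded[of k] that by (auto elim!: eventually_mono)
  qed auto
  have mean_zero: "(\<Sum>k = 1..n. expectation (X k)) = 0"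
    using centered by simp
  \<comment> \<open>The summand \<open>0\<close> stands for the mean of the sum, matching the form
    of \<open>Hoeffding_ineq_ge\<close>.\<close>
  have "{\<omega> \<in> space M. emp_mean X n \<omega> \<ge> x} = {\<omega> \<in> space M. (\<Sum>k = 1..n. X k \<omega>) \<ge> 0 + real n * x}"
    using \<open>n \<ge> 1\<close> by (auto simp: emp_mean_def field_simps)
  also have "prob \<dots> \<le> exp (- 2 * (real n * x)\<^sup>2 / (\<Sum>k = 1..n. (c - - c)\<^sup>2))"
    using Hoeffding_ineq_ge[of "real n * x"] assms unfolding mean_zero by simp
  \<comment> \<open>The denominator is 4 n c^2, which cancels one factor n.\<close>
  also have "- 2 * (real n * x)\<^sup>2 / (\<Sum>k = 1..n. (c - - c)\<^sup>2) = - (real n * (x\<^sup>2 / (2 * c\<^sup>2)))"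
    using \<open>n \<ge> 1\<close> \<open>c > 0\<close> by (simp add: field_simps power2_eq_square)
  finally show ?thesis .
qed

theorem theorem2p1:
  fixes M :: "'a measure" and X :: "nat \<Rightarrow> 'a \<Rightarrow> real"
  assumes "prob_space M"
    and "prob_space.indep_vars M (\<lambda>_. borel) X {1..}"
    and "\<forall>k\<ge>1. prob_space.expectation M (X k) = 0"
    and "\<exists>c0>0. \<forall>k\<ge>1. AE \<omega> in M. \<bar>X k \<omega>\<bar> \<le> c0"
    and "\<exists>c1>0. \<forall>k\<ge>1. prob_space.variance M (X k) \<ge> c1"
  shows "\<exists>J :: real \<Rightarrow> real. \<forall>x>0. J x > 0 \<and>
    limsup (\<lambda>n. ereal (1 / real n) * elog (measure M {\<omega> \<in> space M. emp_mean X n \<omega> \<ge> x}))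
      \<le> - ereal (J x)"
proof -
  interpret prob_space M by fact
  obtain c where c: "c > 0" "\<And>k. k \<ge> 1 \<Longrightarrow> AE \<omega> in M. \<bar>X k \<omega>\<bar> \<le> c"
    using assms(4) by blast
  define J where "J x = x\<^sup>2 / (2 * c\<^sup>2)" for x
  have "limsup (\<lambda>n. ereal (1 / real n) * elog (prob {\<omega> \<in> space M. emp_mean X n \<omega> \<ge> x})) \<le> - ereal (J x)"
    if "x > 0" for x
  proof (rule Limsup_bounded, rule eventually_sequentiallyI)
    \<comment> \<open>The bound fails at \<open>n = 0\<close>: there \<open>1 / real n\<close> is 0,
      and 0 times minus infinity is 0 in \<open>ereal\<close>.\<close>
    fix n :: nat assume n: "n \<ge> 1"
    have "elog (prob {\<omega> \<in> space M. emp_mean X n \<omega> \<ge> x}) \<le> ereal (- (real n * J x))"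
      using prob_emp_mean_ge_le[OF assms(2) _ c(2,1)] assms(3) n \<open>x > 0\<close>
      by (simp add: elog_le_iff J_def)
    then have "ereal (1 / real n) * elog (prob {\<omega> \<in> space M. emp_mean X n \<omega> \<ge> x})
        \<le> ereal (1 / real n) * ereal (- (real n * J x))"
      by (rule ereal_mult_left_mono) simp
    also have "\<dots> = - ereal (J x)"
      using n by simp
    finally show "ereal (1 / real n) * elog (prob {\<omega> \<in> space M. emp_mean X n \<omega> \<ge> x}) \<le> - ereal (J x)" .
  qed
  moreover have "J x > 0" if "x > 0" for x
    using that c(1) by (simp add: J_def)
  ultimately show ?thesis by blast
qed

end
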